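(* Let every user's item list have exactly $K=2$ items, and let the modification cost scale be $\alpha=0$. For any $\epsilon>0$ and any $N$, there exist a recommendation graph $G$ over $N$ distinct item lists $X_1,\dots,X_N$ and a corresponding model $f$ (an assignment of unit-norm embeddings to the users) such that the average diversity of the strategically modified lists, $\frac1N\sum_{i=1}^N \mathrm{div}(X_i^f,r_i^f)$, is at least $$(1-\epsilon)\left(1-\frac{3}{N}\right).$$
   Context: All feature vectors lie in $\mathbb{R}^d$ with $d\ge 2$. $N$ is a positive integer, the number of lists (one list per user). A recommendation graph $G$ is a bipartite graph between users $i$ and items $j$, where $(i,j)$ is an edge if and only if item $j$ belongs to the list $X_i$ of candidate items of user $i$; $U_j=\{i : (i,j)\text{ is an edge}\}$ is the set of users associated with item $j$. The same item may appear in several lists. Each item $j$ has a feature vector $x_j\in\mathbb{R}^d$ with $\|x_j\|_2=1$. A model $f$ is given by an assignment of an embedding $u_i\in\mathbb{R}^d$ with $\|u_i\|_2=1$ to every user $i$; the score of item $x$ for user $i$ is $f(x;u_i)=u_i^\top x$. Average user of item $j$: $v_j=\frac{1}{|U_j|}\sum_{i\in U_j}u_i$ and $\tilde v_j=v_j/\|v_j\|_2$ (defined when $v_j\neq 0$). Best response of item $j$ with cost scale $\alpha\ge 0$: $\Delta_f(x_j)=\operatorname{argmax}_{x'\in\mathbb{R}^d,\ \|x'\|_2=1}\ \tilde v_j^\top x'-\alpha\|x_j-x'\|_2^2$. For $\alpha=0$ this gives $\Delta_f(x_j)=\tilde v_j$. $X_i^f$ is the list obtained from $X_i$ by replacing each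 item $x_j$ by $\Delta_f(x_j)$, and $r_i^f$ is the ranking of the items of $X_i^f$ by user $i$'s score. Diversity: for a list $X$ of unit-norm items and a ranking $r$, with $x_{r(j)}$ the $j$-th ranked item, the diversity of the top $k$ items is $\mathrm{div}(X,r)=\frac{1}{k(k-1)}\sum_{j,\ell=1}^{k}\bigl(1-\cos(x_{r(j)},x_{r(\ell)})\bigr)$, where $\cos(x,x')=\frac{x^\top x'}{\|x\|_2\|x'\|_2}$. Here $k=K=2$, so both items of each list are counted and the ranking plays no role.
   Formalization: The claim fails for N=1 with ε>1 (diversity is 0 but the bound is positive) and for N=2 with ε≥3 (diversity is below 1 but the bound is at least 1); exactly these cases are excluded. *)

theory Defs
  imports "HOL-Analysis.Analysis"
begin

text \<open>A recommendation graph is its edge set: \<open>(i, j) \<in> G\<close> means that item \<open>j\<close> is a candidate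
  item of user \<open>i\<close>. Both sides are indexed by natural numbers, and the components of a pair keep
  them apart. The items of the graph are \<open>Range G\<close>.\<close>

type_synonym rec_graph = "(nat \<times> nat) set"

definition item_list :: "rec_graph \<Rightarrow> nat \<Rightarrow> nat set" where
  "item_list G i = {j. (i, j) \<in> G}"

definition item_users :: "rec_graph \<Rightarrow> nat \<Rightarrow> nat set" where
  "item_users G j = {i. (i, j) \<in> G}"

definition avg_user :: "rec_graph \<Rightarrow> (nat \<Rightarrow> 'v::real_normed_vector) \<Rightarrow> nat \<Rightarrow> 'v" where
  "avg_user G u j = (1 / real (card (item_users G j))) *\<^sub>R (\<Sum>i\<in>item_users G j. u i)"

definition avg_user_dir :: "rec_graph \<Rightarrow> (nat \<Rightarrow> 'v::real_normed_vector) \<Rightarrow> nat \<Rightarrow> 'v" where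
  "avg_user_dir G u j = (1 / norm (avg_user G u j)) *\<^sub>R avg_user G u j"

definition best_response ::
    "real \<Rightarrow> rec_graph \<Rightarrow> (nat \<Rightarrow> 'v::euclidean_space) \<Rightarrow> (nat \<Rightarrow> 'v) \<Rightarrow> nat \<Rightarrow> 'v" where
  "best_response \<alpha> G u x j =
     arg_max_on (\<lambda>x'. avg_user_dir G u j \<bullet> x' - \<alpha> * (norm (x j - x'))\<^sup>2) {x'. norm x' = 1}"

text \<open>Positions start at \<open>1\<close>, and tied items may come in either order. A ranking orders item
  indices rather than vectors, because two items of a list may have the same best response.\<close>

definition is_ranking :: "nat set \<Rightarrow> (nat \<Rightarrow> real) \<Rightarrow> (nat \<Rightarrow> nat) \<Rightarrow> bool" where
  "is_ranking A score r \<longleftrightarrow>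
     bij_betw r {1..card A} A \<and>
     (\<forall>a\<in>{1..card A}. \<forall>b\<in>{1..card A}. a \<le> b \<longrightarrow> score (r b) \<le> score (r a))"

definition cos_sim :: "'v::real_inner \<Rightarrow> 'v \<Rightarrow> real" where
  "cos_sim x y = (x \<bullet> y) / (norm x * norm y)"

text \<open>Diversity of the top \<open>k\<close> items under the ranking \<open>r\<close>, where \<open>y\<close> gives the feature vectors.\<close>

definition diversity :: "nat \<Rightarrow> (nat \<Rightarrow> 'v::real_inner) \<Rightarrow> (nat \<Rightarrow> nat) \<Rightarrow> real" where
  "diversity k y r =
     1 / (real k * (real k - 1)) * (\<Sum>a=1..k. \<Sum>b=1..k. 1 - cos_sim (y (r a)) (y (r b)))"

lemma is_ranking_exists:
  assumes "finite A"
  shows "\<exists>r. is_ranking A score r"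
proof -
  define ys where "ys = sort_key (\<lambda>j. - score j) (sorted_list_of_set A)"
  have ys: "set ys = A" "distinct ys" "length ys = card A"
    using assms by (simp_all add: ys_def)
  have "sorted (map (\<lambda>j. - score j) ys)"
    by (simp add: ys_def)
  then have anti: "score (ys ! n) \<le> score (ys ! m)" if "m \<le> n" "n < card A" for m n
    using that ys(3) by (auto simp: sorted_iff_nth_mono)
  have "bij_betw (\<lambda>a. a - 1) {1..card A} {..<card A}"
    by (rule bij_betw_byWitness[where f' = Suc]) auto
  moreover have "bij_betw ((!) ys) {..<card A} A"
    using ys by (intro bij_betw_nth) auto
  ultimately have "bij_betw ((!) ys \<circ> (\<lambda>a. a - 1)) {1..card A} A"
    by (rule bij_betw_trans)
  then have "is_ranking A score ((!) ys \<circ> (\<lambda>a. a - 1))"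
    unfolding is_ranking_def by (auto intro!: anti)
  then show ?thesis
    by blast
qed

lemma best_response_zero_cost:
  assumes "avg_user G u j \<noteq> 0"
  shows "best_response 0 G u x j = avg_user_dir G u j"
proof -
  let ?w = "avg_user_dir G u j"
  have w: "norm ?w = 1"
    using assms by (simp add: avg_user_dir_def)
  have le: "?w \<bullet> y \<le> 1" if "norm y = 1" for y
    using norm_cauchy_schwarz[of ?w y] w that by simp
  have ww: "?w \<bullet> ?w = 1"
    using w by (simp add: dot_square_norm)
  have uniq: "y = ?w" if "norm y = 1" "\<not> ?w \<bullet> y < 1" for y
  proof -
    have "?w \<bullet> y = norm ?w * norm y"
      using le[of y] that w by simp
    then have "norm ?w *\<^sub>R y = norm y *\<^sub>R ?w"
      by (simp only: norm_cauchy_schwarz_eq)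
    then show ?thesis
      using w that(1) by simp
  qed
  have "is_arg_max (\<lambda>x'. ?w \<bullet> x' - 0 * (norm (x j - x'))\<^sup>2) (\<lambda>x'. x' \<in> {x'. norm x' = 1}) y
        \<longleftrightarrow> y = ?w" for y
    using w ww le uniq[of y] by (fastforce simp: is_arg_max_def)
  then show ?thesis
    by (simp add: best_response_def arg_max_on_def arg_max_def)
qed

text \<open>The hypotheses \<open>N = 1 \<Longrightarrow> \<epsilon> \<le> 1\<close> and \<open>N = 2 \<Longrightarrow> \<epsilon> < 3\<close> of the theorem only remove cases
  in which the bound is out of reach. For \<open>N = 1\<close> both items move to \<open>u 1\<close>, so the diversity is
  \<open>0\<close>, while the bound is \<open>2 * (\<epsilon> - 1)\<close>. For \<open>N = 2\<close> the distinct lists share at most one item,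
  so the average diversity is \<open>0\<close> or \<open>1 - cos (\<theta> / 2)\<close>, where \<open>\<theta> < \<pi>\<close> is the angle between
  \<open>u 1\<close> and \<open>u 2\<close>; this is less than \<open>1\<close>, while the bound is \<open>(\<epsilon> - 1) / 2\<close>.
  The features \<open>x\<close> are injective on items, so lists that differ as sets of items also differ as
  sets of feature vectors.\<close>

end

theory Submission
  imports Defs
begin

text \<open>Take a star: every user has one private item and all users share the hub item \<open>0\<close>. A private
  item moves onto its user. The users come in pairs \<open>s *\<^sub>R b \<plusminus> sqrt (1 - s\<^sup>2) *\<^sub>R a\<close> with \<open>a\<close>, \<open>b\<close>
  orthonormal and \<open>s > 0\<close> small (for odd \<open>N\<close> the last user is \<open>b\<close> itself), so the \<open>a\<close>-components cancel
  and the hub moves to \<open>b\<close>, which is almost orthogonal to every paired user.\<close>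

text \<open>Reindexing both sums along the bijection \<open>r\<close> makes the value independent of
  the order of the two items. The diagonal terms vanish, and the two equal off-diagonal terms offset
  the normalising factor 1/2.\<close>

lemma diversity_two:
  assumes r: "bij_betw r {1..2} {p, q}" and "p \<noteq> q"
    and n: "norm (y p) = 1" "norm (y q) = 1"
  shows "diversity 2 y r = 1 - y p \<bullet> y q"
proof -
  have "(\<Sum>a=1..2. \<Sum>b=1..2. 1 - cos_sim (y (r a)) (y (r b)))
      = (\<Sum>a\<in>{p, q}. \<Sum>b\<in>{p, q}. 1 - cos_sim (y a) (y b))"
    by (subst sum.reindex_bij_betw[OF r]) (rule sum.reindex_bij_betw[OF r])
  also have "\<dots> = 2 * (1 - y p \<bullet> y q)"
    using \<open>p \<noteq> q\<close> n by (simp add: cos_sim_def dot_square_norm inner_commute)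
  finally show ?thesis
    by (simp add: diversity_def)
qed

text \<open>Users are numbered from 1, so index \<open>0\<close> is free for the hub and user
  \<open>i\<close> can own private item \<open>i\<close>.\<close>

definition star_graph :: "nat \<Rightarrow> rec_graph" where
  "star_graph N = {(i, j). i \<in> {1..N} \<and> (j = 0 \<or> j = i)}"

lemma item_list_star: "i \<in> {1..N} \<Longrightarrow> item_list (star_graph N) i = {0, i}"
  by (auto simp: item_list_def star_graph_def)

lemma Range_star: "j \<in> Range (star_graph N) \<longleftrightarrow> N \<ge> 1 \<and> j \<le> N"
  by (cases "j = 0") (force simp: star_graph_def)+

lemma item_users_star_hub: "item_users (star_graph N) 0 = {1..N}"
  by (auto simp: item_users_def star_graph_def)

lemma item_users_star_leaf: "i \<in> {1..N} \<Longrightarrow> item_users (star_graph N) i = {i}"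
  by (auto simp: item_users_def star_graph_def)

text \<open>For orthonormal \<open>a\<close>, \<open>b\<close> the parameter \<open>s\<close> is the
  cosine of the angle to \<open>b\<close>. The same curve supplies the paired users and the original
  item features.\<close>

definition circle_point :: "'v::real_inner \<Rightarrow> 'v \<Rightarrow> real \<Rightarrow> 'v" where
  "circle_point a b s = s *\<^sub>R b + sqrt (1 - s\<^sup>2) *\<^sub>R a"

text \<open>Users \<open>2m - 1\<close> and \<open>2m\<close> form a mirrored pair, and
  \<open>2 * (N div 2)\<close> counts the paired users. Putting the sign on \<open>a\<close> lets
  the facts about \<open>circle_point\<close> be reused with \<open>- a\<close> in place of
  \<open>a\<close>.\<close>

definition mirror_users :: "'v::real_inner \<Rightarrow> 'v \<Rightarrow> real \<Rightarrow> nat \<Rightarrow> nat \<Rightarrow> 'v" where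
  "mirror_users a b s N i =
     (if i \<le> 2 * (N div 2) then circle_point ((- 1) ^ i *\<^sub>R a) b s else b)"

context
  fixes a b :: "'v::real_inner"
  assumes a: "norm a = 1" and b: "norm b = 1" and ab: "a \<bullet> b = 0"
begin

lemma norm_circle_point:
  assumes "0 \<le> s" "s \<le> 1"
  shows "norm (circle_point a b s) = 1"
proof -
  have "b \<bullet> a = 0" "a \<bullet> a = 1" "b \<bullet> b = 1"
    using a b ab by (simp_all add: dot_square_norm inner_commute)
  then have "circle_point a b s \<bullet> circle_point a b s = s\<^sup>2 + (sqrt (1 - s\<^sup>2))\<^sup>2"
    by (simp only: circle_point_def inner_add_left inner_add_right inner_scaleR_left
        inner_scaleR_right ab power2_eq_square mult_zero_right mult_1_right add_0_left add_0_right)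
  also have "\<dots> = 1"
    using assms by (simp add: power_le_one)
  finally have "circle_point a b s \<bullet> circle_point a b s = 1" .
  then show ?thesis
    by (simp add: norm_eq_sqrt_inner)
qed

lemma circle_point_inner: "circle_point a b s \<bullet> b = s"
  using b ab by (simp add: circle_point_def inner_simps dot_square_norm)

end

lemma sum_alternating: "(\<Sum>i=1..2 * m. (- 1) ^ i) = (0::'a::ring_1)"
  by (induction m) auto

context
  fixes a b :: "'v::real_inner" and s :: real and N :: nat
  assumes a: "norm a = 1" and b: "norm b = 1" and ab: "a \<bullet> b = 0"
    and s: "0 < s" "s < 1"
begin

lemma norm_mirror_users: "norm (mirror_users a b s N i) = 1"
  using norm_circle_point[of "(- 1) ^ i *\<^sub>R a" b s] a b ab s
  by (simp add: mirror_users_def power_abs)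

lemma mirror_users_inner:
  "mirror_users a b s N i \<bullet> b = (if i \<le> 2 * (N div 2) then s else 1)"
  using circle_point_inner[of "(- 1) ^ i *\<^sub>R a" b s] a b ab
  by (simp add: mirror_users_def power_abs dot_square_norm)

text \<open>The signs cancel within each pair, while every user has a positive
  \<open>b\<close>-component (\<open>s\<close> or 1). Having \<open>c > 0\<close> makes the average
  nonzero and makes it normalise to \<open>b\<close> rather than \<open>- b\<close>.\<close>

lemma sum_mirror_users:
  assumes "N \<ge> 1"
  obtains c where "c > 0" "(\<Sum>i=1..N. mirror_users a b s N i) = c *\<^sub>R b"
proof -
  define M where "M = 2 * (N div 2)"
  define w where "w i = (if i \<le> M then s else 1)" for i
  define v where "v i = (if i \<le> M then (- 1) ^ i * sqrt (1 - s\<^sup>2) else 0)" for i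
  have "M \<le> N"
    by (simp add: M_def)
  have "mirror_users a b s N i = w i *\<^sub>R b + v i *\<^sub>R a" for i
    by (simp add: mirror_users_def circle_point_def w_def v_def M_def mult.commute)
  then have "(\<Sum>i=1..N. mirror_users a b s N i) = (\<Sum>i=1..N. w i) *\<^sub>R b + (\<Sum>i=1..N. v i) *\<^sub>R a"
    by (simp add: sum.distrib scaleR_left.sum)
  \<comment> \<open>An unpaired last user has no \<open>a\<close>-component, so the sum can stop at
    the even number \<open>M\<close>, where the alternating signs add up to 0.\<close>
  also have "(\<Sum>i=1..N. v i) = (\<Sum>i=1..M. v i)"
    using \<open>M \<le> N\<close> by (intro sum.mono_neutral_right) (auto simp: v_def)
  also have "\<dots> = (\<Sum>i=1..M. (- 1) ^ i) * sqrt (1 - s\<^sup>2)"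
    unfolding sum_distrib_right by (intro sum.cong) (auto simp: v_def)
  also have "\<dots> = 0"
    by (simp only: M_def sum_alternating mult_zero_left)
  finally have "(\<Sum>i=1..N. mirror_users a b s N i) = (\<Sum>i=1..N. w i) *\<^sub>R b"
    by simp
  moreover have "(\<Sum>i=1..N. w i) > 0"
    using s assms by (intro sum_pos) (auto simp: w_def)
  ultimately show thesis
    using that by blast
qed

text \<open>Each paired user contributes \<open>1 - s\<close>; an unpaired user coincides with the
  hub direction \<open>b\<close> and contributes 0.\<close>

lemma sum_mirror_diversity:
  "(\<Sum>i=1..N. 1 - b \<bullet> mirror_users a b s N i) = (1 - s) * real (2 * (N div 2))"
proof -
  have "(\<Sum>i=1..N. 1 - b \<bullet> mirror_users a b s N i)
      = (\<Sum>i=1..N. if i \<le> 2 * (N div 2) then 1 - s else 0)"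
    by (intro sum.cong) (auto simp: inner_commute[of b] mirror_users_inner)
  also have "\<dots> = (\<Sum>i=1..2 * (N div 2). 1 - s)"
    by (intro sum.mono_neutral_cong_right) auto
  finally show ?thesis
    by simp
qed

end

lemma star_hub_direction:
  assumes "N \<ge> 1" "c > 0" "norm b = 1" "(\<Sum>i=1..N. u i) = c *\<^sub>R b"
  shows "avg_user (star_graph N) u 0 \<noteq> 0" "avg_user_dir (star_graph N) u 0 = b"
proof -
  have avg: "avg_user (star_graph N) u 0 = (c / real N) *\<^sub>R b"
    using assms by (simp add: avg_user_def item_users_star_hub)
  show "avg_user (star_graph N) u 0 \<noteq> 0" "avg_user_dir (star_graph N) u 0 = b"
    using assms by (auto simp: avg_user_dir_def avg)
qed

lemma star_leaf_direction:
  assumes "i \<in> {1..N}" "norm (u i) = 1"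
  shows "avg_user (star_graph N) u i \<noteq> 0" "avg_user_dir (star_graph N) u i = u i"
  using assms by (auto simp: avg_user_dir_def avg_user_def item_users_star_leaf)

text \<open>The inequality is the desired bound multiplied by \<open>N\<close>, with the total
  diversity of the star on the right.\<close>

lemma mirror_angle_exists:
  fixes \<epsilon> :: real
  assumes "\<epsilon> > 0" "N \<ge> 1" "N = 1 \<Longrightarrow> \<epsilon> \<le> 1" "N = 2 \<Longrightarrow> \<epsilon> < 3"
  obtains s where "0 < s" "s < 1" "(1 - \<epsilon>) * (real N - 3) \<le> (1 - s) * real (2 * (N div 2))"
proof (cases "(1 - \<epsilon>) * (real N - 3) \<le> 0")
  case True
  \<comment> \<open>The left side is nonpositive here, so any \<open>s\<close> strictly between 0
    and 1 works.\<close>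
  have "0 \<le> (1 - 1 / 2) * real (2 * (N div 2))"
    by simp
  with True show thesis
    by (intro that[of "1 / 2"]) linarith+
next
  case False
  then consider "N < 3" "\<epsilon> > 1" | "N > 3" "\<epsilon> < 1"
    by (auto simp: not_le zero_less_mult_iff)
  then show thesis
  proof cases
    case 1
    with assms have "N = 2"
      by (cases "N = 1") auto
    \<comment> \<open>For \<open>N = 2\<close> the claim reads \<epsilon> - 1 \<le> 2 (1 - s). The
      chosen \<open>s\<close> gives equality and lies in (0, 1) because 1 < \<epsilon> < 3.\<close>
    with 1 assms show thesis
      by (intro that[of "(3 - \<epsilon>) / 2"]) (auto simp: field_simps)
  next
    case 2
    \<comment> \<open>At most one user is unpaired, so at least \<open>N - 1\<close> are paired;
      then \<open>s\<close> = \<epsilon> suffices.\<close>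
    have "real N - 3 \<le> real (2 * (N div 2))"
      by linarith
    with 2 assms show thesis
      by (intro that[of \<epsilon>] mult_left_mono) auto
  qed
qed

theorem proposition3:
  fixes \<epsilon> :: real and N :: nat
  assumes "CARD('d::finite) \<ge> 2"
    and "\<epsilon> > 0" and "N \<ge> 1"
    and "N = 1 \<Longrightarrow> \<epsilon> \<le> 1" and "N = 2 \<Longrightarrow> \<epsilon> < 3"
  shows "\<exists>(G :: rec_graph) (x :: nat \<Rightarrow> real ^ 'd) (u :: nat \<Rightarrow> real ^ 'd).
    Domain G \<subseteq> {1..N} \<and>
    (\<forall>i\<in>{1..N}. card (item_list G i) = 2) \<and>
    inj_on (item_list G) {1..N} \<and>
    inj_on x (Range G) \<and>
    (\<forall>j\<in>Range G. norm (x j) = 1) \<and>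
    (\<forall>i\<in>{1..N}. norm (u i) = 1) \<and>
    (\<forall>j\<in>Range G. avg_user G u j \<noteq> 0) \<and>
    (\<forall>r :: nat \<Rightarrow> nat \<Rightarrow> nat.
       (\<forall>i\<in>{1..N}. is_ranking (item_list G i) (\<lambda>j. u i \<bullet> best_response 0 G u x j) (r i)) \<longrightarrow>
       1 / real N * (\<Sum>i=1..N. diversity 2 (best_response 0 G u x) (r i))
         \<ge> (1 - \<epsilon>) * (1 - 3 / real N))"
proof -
  obtain k l :: 'd where "k \<noteq> l"
    using assms(1) card_le_Suc0_iff_eq[of "UNIV :: 'd set"] by auto
  define a b :: "real ^ 'd" where "a = axis k 1" and "b = axis l 1"
  have ab: "norm a = 1" "norm b = 1" "a \<bullet> b = 0"
    using \<open>k \<noteq> l\<close> by (auto simp: a_def b_def inner_axis_axis)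
  obtain s where s: "0 < s" "s < 1"
    and bound: "(1 - \<epsilon>) * (real N - 3) \<le> (1 - s) * real (2 * (N div 2))"
    using mirror_angle_exists assms(2-5) by blast
  define G where "G = star_graph N"
  define u where "u = mirror_users a b s N"
  \<comment> \<open>At zero cost items move regardless of their features, so any injective family of
    unit vectors serves. Here the inner product with \<open>b\<close> is \<open>1 / (j + 1)\<close>,
    which recovers \<open>j\<close>.\<close>
  define x where "x j = circle_point a b (1 / real (Suc j))" for j
  let ?y = "best_response 0 G u x"
  have norm_u: "norm (u i) = 1" for i
    using norm_mirror_users ab s by (simp add: u_def)
  obtain c where c: "c > 0" "(\<Sum>i=1..N. u i) = c *\<^sub>R b"
    using sum_mirror_users[OF ab s assms(3)] unfolding u_def by blast
  note hub = star_hub_direction[OF assms(3) c(1) ab(2) c(2), folded G_def]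
  have leaf: "avg_user G u i \<noteq> 0" "avg_user_dir G u i = u i" if "i \<in> {1..N}" for i
    using star_leaf_direction[of i N u] that norm_u by (simp_all add: G_def)
  have y_hub: "?y 0 = b" and y_leaf: "?y i = u i" if "i \<in> {1..N}" for i
    using that hub leaf by (simp_all add: best_response_zero_cost)
  have lists: "item_list G i = {0, i}" if "i \<in> {1..N}" for i
    using that by (simp add: G_def item_list_star)
  have "Domain G \<subseteq> {1..N}"
    by (auto simp: G_def star_graph_def)
  moreover have "\<forall>i\<in>{1..N}. card (item_list G i) = 2"
    by (simp add: lists)
  moreover have "inj_on (item_list G) {1..N}"
    by (auto intro!: inj_onI simp: lists doubleton_eq_iff)
  moreover have "inj x"
  proof (rule injI)
    fix i j
    assume "x i = x j"
    then have "x i \<bullet> b = x j \<bullet> b"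
      by simp
    then show "i = j"
      by (simp add: x_def circle_point_inner[OF ab])
  qed
  then have "inj_on x (Range G)"
    by (rule inj_on_subset) simp
  moreover have "norm (x j) = 1" for j
    unfolding x_def by (rule norm_circle_point[OF ab]) auto
  moreover have "avg_user G u j \<noteq> 0" if "j \<in> Range G" for j
    using that hub leaf by (cases "j = 0") (auto simp: G_def Range_star)
  moreover have "(1 - \<epsilon>) * (1 - 3 / real N) \<le> 1 / real N * (\<Sum>i=1..N. diversity 2 ?y (r i))"
    if r: "\<forall>i\<in>{1..N}. is_ranking (item_list G i) (\<lambda>j. u i \<bullet> ?y j) (r i)" for r
  proof -
    have div: "diversity 2 ?y (r i) = 1 - b \<bullet> u i" if i: "i \<in> {1..N}" for i
    proof -
      have "bij_betw (r i) {1..2} {0, i}"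
        using r[rule_format, OF i] i by (simp add: is_ranking_def lists numeral_2_eq_2)
      then have "diversity 2 ?y (r i) = 1 - ?y 0 \<bullet> ?y i"
        using i norm_u ab by (intro diversity_two) (auto simp: y_hub[OF i] y_leaf[OF i])
      then show ?thesis
        by (simp only: y_hub[OF i] y_leaf[OF i])
    qed
    \<comment> \<open>Factoring out \<open>1 / N\<close> brings the target into the form in which
      \<open>s\<close> was chosen.\<close>
    have "(1 - \<epsilon>) * (1 - 3 / real N) = 1 / real N * ((1 - \<epsilon>) * (real N - 3))"
      using assms(3) by (simp add: field_simps)
    also have "\<dots> \<le> 1 / real N * ((1 - s) * real (2 * (N div 2)))"
      by (intro mult_left_mono bound) simp
    also have "\<dots> = 1 / real N * (\<Sum>i=1..N. diversity 2 ?y (r i))"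
      unfolding sum_mirror_diversity[OF ab s, symmetric] using div by (simp add: u_def)
    finally show ?thesis .
  qed
  ultimately show ?thesis
    using norm_u by (intro exI[of _ G] exI[of _ x] exI[of _ u]) (intro conjI allI ballI impI; simp)
qed

end
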